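(* Let $\psi\colon G\twoheadrightarrow H$ be an epimorphism of groups. If $\psi$ is not an isomorphism, then there exist a $G$-graded ring $R$ and a $G$-graded $R$-module $M$ such that $M$ is not free but the $H$-graded $R_{[\psi]}$-module $M_{[\psi]}$ is free of rank $1$.
   Context: Groups are commutative and written additively; rings are commutative with $1$. A $G$-graded ring is a ring $R$ with a family $(R_g)_{g\in G}$ of additive subgroups whose direct sum is $R$ and with $R_gR_h\subseteq R_{g+h}$. A $G$-graded $R$-module is an $R$-module $M$ with a family $(M_g)_{g\in G}$ of additive subgroups whose direct sum is $M$ and with $R_gM_h\subseteq M_{g+h}$. For an epimorphism of groups $\psi\colon G\twoheadrightarrow H$, the $\psi$-coarsening $R_{[\psi]}$ (resp. $M_{[\psi]}$) is the $H$-graded ring (resp. $H$-graded $R_{[\psi]}$-module) with the same underlying ring (resp. module) and with component of degree $h\in H$ equal to $\bigoplus_{g\in\psi^{-1}(h)}R_g$ (resp. $\bigoplus_{g\in\psi^{-1}(h)}M_g$). A graded module is free if it has a basis consisting of homogeneous elements; its rank is the cardinality of such a basis. *)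

theory Defs
  imports
    "Jordan_Normal_Form.Missing_VectorSpace"
    "HOL-Algebra.Free_Abelian_Groups"
begin

section \<open>Graded rings and modules\<close>

text \<open>
  The grading groups are commutative groups in the sense of \<open>comm_group\<close>; their operation is
  written multiplicatively, as always in HOL-Algebra. A grading is a function on the type of
  group elements of which only the values on \<open>carrier G\<close> matter.

  The internal direct sum is expressed through the canonical map out of the external direct sum
  \<open>sum_group\<close> (the families of finite support), \<open>gfinprod\<close> being the sum over the support.
\<close>

definition is_direct_sum :: "('a, 'r) ring_scheme \<Rightarrow> 'i set \<Rightarrow> ('i \<Rightarrow> 'a set) \<Rightarrow> bool" where
  "is_direct_sum M I A \<longleftrightarrow>
     (\<forall>i\<in>I. subgroup (A i) (add_monoid M)) \<and>
     (\<lambda>x. gfinprod (add_monoid M) x I)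
       \<in> iso (sum_group I (\<lambda>i. (add_monoid M)\<lparr>carrier := A i\<rparr>)) (add_monoid M)"

text \<open>Equivalently, every element has a unique decomposition of finite support.\<close>

lemma is_direct_sum_iff:
  assumes "abelian_group M"
  shows "is_direct_sum M I A \<longleftrightarrow>
     (\<forall>i\<in>I. subgroup (A i) (add_monoid M)) \<and>
     (\<forall>y\<in>carrier M. \<exists>!x. x \<in> (\<Pi>\<^sub>E i\<in>I. A i) \<and> finite {i \<in> I. x i \<noteq> \<zero>\<^bsub>M\<^esub>} \<and>
        (\<Oplus>\<^bsub>M\<^esub>i\<in>{i \<in> I. x i \<noteq> \<zero>\<^bsub>M\<^esub>}. x i) = y)"
proof (cases "\<forall>i\<in>I. subgroup (A i) (add_monoid M)")
  case True
  interpret M: abelian_group M by fact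
  define D where "D = sum_group I (\<lambda>i. (add_monoid M)\<lparr>carrier := A i\<rparr>)"
  define s where "s = (\<lambda>x. gfinprod (add_monoid M) x I)"
  have grp: "group ((add_monoid M)\<lparr>carrier := A i\<rparr>)" if "i \<in> I" for i
    using M.add.subgroup_imp_group True that by auto
  have AM: "A i \<subseteq> carrier M" if "i \<in> I" for i
    using True that subgroup.subset by fastforce
  have cD: "carrier D = {x \<in> \<Pi>\<^sub>E i\<in>I. A i. finite {i \<in> I. x i \<noteq> \<zero>\<^bsub>M\<^esub>}}"
    using carrier_sum_group[of I "\<lambda>i. (add_monoid M)\<lparr>carrier := A i\<rparr>"] grp unfolding D_def by simp
  have mD: "x \<otimes>\<^bsub>D\<^esub> y = (\<lambda>i\<in>I. x i \<oplus>\<^bsub>M\<^esub> y i)" for x y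
    unfolding D_def by simp
  have fM: "x \<in> I \<rightarrow> carrier M" if "x \<in> carrier D" for x
    using that AM unfolding cD by (auto simp: PiE_iff)
  have "s \<in> hom D (add_monoid M)"
  proof (rule homI)
    fix x assume "x \<in> carrier D"
    then show "s x \<in> carrier (add_monoid M)"
      using M.add.gfinprod_closed[of x I] fM by (simp add: s_def)
  next
    fix x y assume xy: "x \<in> carrier D" "y \<in> carrier D"
    have "s (x \<otimes>\<^bsub>D\<^esub> y) = gfinprod (add_monoid M) (\<lambda>i. x i \<otimes>\<^bsub>add_monoid M\<^esub> y i) I"
      unfolding s_def mD using fM[OF xy(1)] fM[OF xy(2)]
      by (intro M.add.gfinprod_cong) (auto simp: simp_implies_def Pi_iff)
    also have "\<dots> = s x \<otimes>\<^bsub>add_monoid M\<^esub> s y"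
      using M.add.gfinprod_distrib[of I x y] fM[OF xy(1)] fM[OF xy(2)] xy
      by (simp add: s_def cD)
    finally show "s (x \<otimes>\<^bsub>D\<^esub> y) = s x \<otimes>\<^bsub>add_monoid M\<^esub> s y" .
  qed
  moreover have "s x = (\<Oplus>\<^bsub>M\<^esub>i\<in>{i \<in> I. x i \<noteq> \<zero>\<^bsub>M\<^esub>}. x i)" if "x \<in> carrier D" for x
    using that unfolding cD s_def gfinprod_def finsum_def by simp
  moreover have "s x \<in> carrier M" if "x \<in> carrier D" for x
    using M.add.gfinprod_closed[of x I] fM[OF that] by (simp add: s_def)
  ultimately have s: "s \<in> hom D (add_monoid M)"
    "\<And>x. x \<in> carrier D \<Longrightarrow> s x = (\<Oplus>\<^bsub>M\<^esub>i\<in>{i \<in> I. x i \<noteq> \<zero>\<^bsub>M\<^esub>}. x i)"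
    "\<And>x. x \<in> carrier D \<Longrightarrow> s x \<in> carrier M"
    by blast+
  have "bij_betw s (carrier D) (carrier M) \<longleftrightarrow> (\<forall>y\<in>carrier M. \<exists>!x. x \<in> carrier D \<and> s x = y)"
  proof
    assume bij: "bij_betw s (carrier D) (carrier M)"
    show "\<forall>y\<in>carrier M. \<exists>!x. x \<in> carrier D \<and> s x = y"
    proof
      fix y assume "y \<in> carrier M"
      then obtain x where "x \<in> carrier D" "s x = y"
        using bij_betw_imp_surj_on[OF bij] by (metis imageE)
      then show "\<exists>!x. x \<in> carrier D \<and> s x = y"
        using inj_onD[OF bij_betw_imp_inj_on[OF bij]] by (intro ex1I[of _ x]) simp_all
    qed
  next
    assume *: "\<forall>y\<in>carrier M. \<exists>!x. x \<in> carrier D \<and> s x = y"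
    show "bij_betw s (carrier D) (carrier M)"
    proof (rule bij_betw_imageI)
      show "inj_on s (carrier D)"
      proof (rule inj_onI)
        fix x x' assume x: "x \<in> carrier D" "x' \<in> carrier D" "s x = s x'"
        have "\<exists>!z. z \<in> carrier D \<and> s z = s x'"
          using * s(3)[OF x(2)] by (rule bspec)
        then show "x = x'"
          using x by (elim ex1E) metis
      qed
      show "s ` carrier D = carrier M"
      proof (intro subset_antisym image_subsetI subsetI)
        fix y assume "y \<in> carrier M"
        then have "\<exists>!x. x \<in> carrier D \<and> s x = y"
          by (rule bspec[OF *])
        then show "y \<in> s ` carrier D"
          by (elim ex1E conjE) (metis imageI)
      qed (rule s(3))
    qed
  qed
  then have "s \<in> iso D (add_monoid M) \<longleftrightarrow> (\<forall>y\<in>carrier M. \<exists>!x. x \<in> carrier D \<and> s x = y)"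
    using s(1) by (simp add: iso_def)
  also have "\<dots> \<longleftrightarrow>
     (\<forall>y\<in>carrier M. \<exists>!x. x \<in> carrier D \<and> (\<Oplus>\<^bsub>M\<^esub>i\<in>{i \<in> I. x i \<noteq> \<zero>\<^bsub>M\<^esub>}. x i) = y)"
    using s(2) by (simp cong: conj_cong)
  finally have "s \<in> iso D (add_monoid M) \<longleftrightarrow>
     (\<forall>y\<in>carrier M. \<exists>!x. x \<in> carrier D \<and> (\<Oplus>\<^bsub>M\<^esub>i\<in>{i \<in> I. x i \<noteq> \<zero>\<^bsub>M\<^esub>}. x i) = y)" .
  then show ?thesis
    using True unfolding is_direct_sum_def D_def[symmetric] s_def[symmetric] cD by simp
next
  case False
  then show ?thesis by (simp only: is_direct_sum_def simp_thms)
qed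

definition graded_ring ::
  "('g, 'm) monoid_scheme \<Rightarrow> ('a, 'r) ring_scheme \<Rightarrow> ('g \<Rightarrow> 'a set) \<Rightarrow> bool" where
  "graded_ring G R \<R> \<longleftrightarrow>
     comm_group G \<and> cring R \<and> is_direct_sum R (carrier G) \<R> \<and>
     (\<forall>g\<in>carrier G. \<forall>h\<in>carrier G. \<forall>a\<in>\<R> g. \<forall>b\<in>\<R> h.
        a \<otimes>\<^bsub>R\<^esub> b \<in> \<R> (g \<otimes>\<^bsub>G\<^esub> h))"

definition graded_module ::
  "('g, 'm) monoid_scheme \<Rightarrow> ('a, 'r) ring_scheme \<Rightarrow> ('g \<Rightarrow> 'a set) \<Rightarrow>
   ('a, 'b, 's) module_scheme \<Rightarrow> ('g \<Rightarrow> 'b set) \<Rightarrow> bool" where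
  "graded_module G R \<R> M \<M> \<longleftrightarrow>
     graded_ring G R \<R> \<and> module R M \<and> is_direct_sum M (carrier G) \<M> \<and>
     (\<forall>g\<in>carrier G. \<forall>h\<in>carrier G. \<forall>a\<in>\<R> g. \<forall>x\<in>\<M> h.
        a \<odot>\<^bsub>M\<^esub> x \<in> \<M> (g \<otimes>\<^bsub>G\<^esub> h))"

text \<open>
  The sum of the components over a fibre of \<open>\<psi>\<close>, inside the ambient ring or module. The sum is
  direct because the components of a grading are independent.
\<close>

definition coarsening ::
  "('g, 'm) monoid_scheme \<Rightarrow> ('g \<Rightarrow> 'h) \<Rightarrow> ('a, 'r) ring_scheme \<Rightarrow> ('g \<Rightarrow> 'a set) \<Rightarrow> 'h \<Rightarrow> 'a set" where
  "coarsening G \<psi> M \<M> h =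
     {(\<Oplus>\<^bsub>M\<^esub>g\<in>S. x g) | S x. finite S \<and> S \<subseteq> {g \<in> carrier G. \<psi> g = h} \<and> x \<in> Pi S \<M>}"

definition homogeneous_basis ::
  "('g, 'm) monoid_scheme \<Rightarrow> ('a, 'r) ring_scheme \<Rightarrow> ('a, 'b, 's) module_scheme \<Rightarrow>
   ('g \<Rightarrow> 'b set) \<Rightarrow> 'b set \<Rightarrow> bool" where
  "homogeneous_basis G R M \<M> B \<longleftrightarrow>
     B \<subseteq> (\<Union>g\<in>carrier G. \<M> g) \<and> module.span R M B = carrier M \<and> \<not> module.lin_dep R M B"

definition graded_free ::
  "('g, 'm) monoid_scheme \<Rightarrow> ('a, 'r) ring_scheme \<Rightarrow> ('a, 'b, 's) module_scheme \<Rightarrow>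
   ('g \<Rightarrow> 'b set) \<Rightarrow> bool" where
  "graded_free G R M \<M> \<longleftrightarrow> (\<exists>B. homogeneous_basis G R M \<M> B)"

definition graded_free_of_rank ::
  "('g, 'm) monoid_scheme \<Rightarrow> ('a, 'r) ring_scheme \<Rightarrow> ('a, 'b, 's) module_scheme \<Rightarrow>
   ('g \<Rightarrow> 'b set) \<Rightarrow> nat \<Rightarrow> bool" where
  "graded_free_of_rank G R M \<M> n \<longleftrightarrow>
     (\<exists>B. homogeneous_basis G R M \<M> B \<and> finite B \<and> card B = n)"

end

theory Submission
  imports Defs "HOL-Number_Theory.Residues"
begin

text \<open>
  Choose \<open>k \<noteq> 1\<close> in the kernel of \<open>\<psi>\<close>, and a ring \<open>R\<close> that is a product of two nonzero rings, that
  is, \<open>R = R e \<oplus> R f\<close> with idempotents \<open>e, f\<close> such that \<open>e f = 0\<close> and \<open>e + f = 1\<close>. Put all of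
  \<open>R\<close> in degree \<open>1\<close>, but spread the module \<open>M = R\<close> over two degrees, with \<open>R e\<close> in degree \<open>1\<close> and
  \<open>R f\<close> in degree \<open>k\<close>. Homogeneous elements of \<open>M\<close> are annihilated by \<open>e\<close> or by \<open>f\<close>, so none of
  them can belong to a basis (\<open>not_graded_free_peirce\<close>). But \<open>\<psi>\<close> sends both degrees to \<open>1\<close>, so
  in \<open>M\<^sub>[\<^sub>\<psi>\<^sub>]\<close> everything is homogeneous of degree \<open>1\<close> (\<open>coarsening_concentrated\<close>), including the
  basis element \<open>1 = e + f\<close>.

  For a ring of integers mod \<open>m\<close> this needs an \<open>m\<close> with two distinct prime factors; the choice
  is \<open>\<int>/6\<close> with \<open>e = 3\<close> and \<open>f = 4\<close>. All gradings that occur, including those that put the whole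
  ring in one degree, are decompositions with respect to a finite family of orthogonal
  idempotents, and the direct sum condition is checked for all of them at once
  (\<open>is_direct_sum_peirce\<close>).
\<close>

section \<open>Decompositions along orthogonal idempotents\<close>

text \<open>
  This is the ideal generated by \<open>e i\<close> if \<open>e i\<close> is idempotent, and the zero ideal if \<open>e i = 0\<close>;
  the fixed-point form makes membership an equation.
\<close>

definition peirce :: "('a, 'r) ring_scheme \<Rightarrow> ('i \<Rightarrow> 'a) \<Rightarrow> 'i \<Rightarrow> 'a set" where
  "peirce R e i = {x \<in> carrier R. e i \<otimes>\<^bsub>R\<^esub> x = x}"

definition complete_orthogonal :: "('a, 'r) ring_scheme \<Rightarrow> 'i set \<Rightarrow> ('i \<Rightarrow> 'a) \<Rightarrow> bool" where
  "complete_orthogonal R I e \<longleftrightarrow>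
     e \<in> I \<rightarrow> carrier R \<and> finite {i \<in> I. e i \<noteq> \<zero>\<^bsub>R\<^esub>} \<and>
     (\<forall>i\<in>I. \<forall>j\<in>I. i \<noteq> j \<longrightarrow> e i \<otimes>\<^bsub>R\<^esub> e j = \<zero>\<^bsub>R\<^esub>) \<and>
     (\<Oplus>\<^bsub>R\<^esub>i\<in>{i \<in> I. e i \<noteq> \<zero>\<^bsub>R\<^esub>}. e i) = \<one>\<^bsub>R\<^esub>"

context cring
begin

text \<open>Multiply \<open>e\<^sub>1 + \<dots> + e\<^sub>n = 1\<close> by \<open>e\<^sub>i\<close>.\<close>

lemma complete_orthogonal_idem:
  assumes "complete_orthogonal R I e" "i \<in> I"
  shows "e i \<otimes> e i = e i"
proof (cases "e i = \<zero>")
  case False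
  let ?J = "{i \<in> I. e i \<noteq> \<zero>}"
  have e: "e \<in> I \<rightarrow> carrier R" and fin: "finite ?J"
    and orth: "\<And>i j. i \<in> I \<Longrightarrow> j \<in> I \<Longrightarrow> i \<noteq> j \<Longrightarrow> e i \<otimes> e j = \<zero>"
    and one: "(\<Oplus>i\<in>?J. e i) = \<one>"
    using assms(1) unfolding complete_orthogonal_def by auto
  have eI: "e j \<in> carrier R" if "j \<in> I" for j using e that by auto
  note ei = eI[OF assms(2)]
  have "e i = e i \<otimes> (\<Oplus>j\<in>?J. e j)" using ei one by simp
  also have "\<dots> = (\<Oplus>j\<in>?J. e i \<otimes> e j)" using eI ei fin by (intro finsum_rdistr) auto
  also have "\<dots> = (\<Oplus>j\<in>?J. if i = j then e j \<otimes> e j else \<zero>)"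
    using eI orth assms(2) by (intro finsum_cong') auto
  also have "\<dots> = e i \<otimes> e i" using eI fin assms(2) False
    by (intro add.finprod_singleton) auto
  finally show ?thesis by simp
qed simp

lemma subgroup_peirce:
  assumes "e i \<in> carrier R"
  shows "subgroup (peirce R e i) (add_monoid R)"
proof (rule add.subgroupI)
  have "\<zero> \<in> peirce R e i" using assms by (simp add: peirce_def)
  then show "peirce R e i \<noteq> {}" by blast
next
  fix x assume "x \<in> peirce R e i"
  then show "\<ominus> x \<in> peirce R e i"
    using assms r_minus[of "e i" x] by (simp add: peirce_def)
qed (use assms in \<open>auto simp: peirce_def r_distr\<close>)

text \<open>
  The component of \<open>y\<close> of index \<open>i\<close> is \<open>e i \<otimes> y\<close>: multiplication by \<open>e i\<close> fixes the summand of
  index \<open>i\<close> and kills the other ones.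
\<close>

lemma is_direct_sum_peirce:
  assumes "complete_orthogonal R I e"
  shows "is_direct_sum R I (peirce R e)"
proof -
  let ?J = "{i \<in> I. e i \<noteq> \<zero>}"
  have e: "e \<in> I \<rightarrow> carrier R" and fin: "finite ?J"
    and orth: "\<And>i j. i \<in> I \<Longrightarrow> j \<in> I \<Longrightarrow> i \<noteq> j \<Longrightarrow> e i \<otimes> e j = \<zero>"
    and one: "(\<Oplus>i\<in>?J. e i) = \<one>"
    using assms(1) unfolding complete_orthogonal_def by auto
  have eI: "e i \<in> carrier R" if "i \<in> I" for i using e that by auto
  have "\<exists>!x. x \<in> (\<Pi>\<^sub>E i\<in>I. peirce R e i) \<and> finite {i \<in> I. x i \<noteq> \<zero>} \<and>
         (\<Oplus>i\<in>{i \<in> I. x i \<noteq> \<zero>}. x i) = y" if y: "y \<in> carrier R" for y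
  proof (rule ex1I)
    let ?x = "\<lambda>i\<in>I. e i \<otimes> y"
    have sub: "{i \<in> I. ?x i \<noteq> \<zero>} \<subseteq> ?J" using y by auto
    have "?x \<in> (\<Pi>\<^sub>E i\<in>I. peirce R e i)"
      using eI y complete_orthogonal_idem[OF assms]
      by (auto simp: peirce_def m_assoc[symmetric])
    moreover have "finite {i \<in> I. ?x i \<noteq> \<zero>}" using sub fin by (rule finite_subset)
    moreover have "(\<Oplus>i\<in>{i \<in> I. ?x i \<noteq> \<zero>}. ?x i) = y"
    proof -
      have "(\<Oplus>i\<in>{i \<in> I. ?x i \<noteq> \<zero>}. ?x i) = (\<Oplus>i\<in>?J. ?x i)"
        using sub fin eI y by (intro add.finprod_mono_neutral_cong_left) auto
      also have "\<dots> = (\<Oplus>i\<in>?J. e i \<otimes> y)"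
        using eI y by (intro finsum_cong') auto
      also have "\<dots> = (\<Oplus>i\<in>?J. e i) \<otimes> y"
        using fin eI y by (intro finsum_ldistr[symmetric]) auto
      finally show ?thesis using one y by simp
    qed
    ultimately show "?x \<in> (\<Pi>\<^sub>E i\<in>I. peirce R e i) \<and> finite {i \<in> I. ?x i \<noteq> \<zero>} \<and>
        (\<Oplus>i\<in>{i \<in> I. ?x i \<noteq> \<zero>}. ?x i) = y" by blast
  next
    fix x assume "x \<in> (\<Pi>\<^sub>E i\<in>I. peirce R e i) \<and> finite {i \<in> I. x i \<noteq> \<zero>} \<and>
        (\<Oplus>i\<in>{i \<in> I. x i \<noteq> \<zero>}. x i) = y"
    then have x: "x \<in> (\<Pi>\<^sub>E i\<in>I. peirce R e i)" and finx: "finite {i \<in> I. x i \<noteq> \<zero>}"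
      and sumx: "(\<Oplus>i\<in>{i \<in> I. x i \<noteq> \<zero>}. x i) = y" by auto
    have xI: "x i \<in> carrier R" "e i \<otimes> x i = x i" if "i \<in> I" for i
      using x that by (auto simp: PiE_iff peirce_def)
    have proj: "x i = e i \<otimes> y" if i: "i \<in> I" for i
    proof -
      have kill: "e i \<otimes> x j = \<zero>" if "j \<in> I" "i \<noteq> j" for j
      proof -
        have "e i \<otimes> x j = (e i \<otimes> e j) \<otimes> x j"
          using xI[OF that(1)] eI i that by (simp add: m_assoc)
        then show ?thesis using orth[OF i that] xI[OF that(1)] by simp
      qed
      have "e i \<otimes> y = (\<Oplus>j\<in>{i \<in> I. x i \<noteq> \<zero>}. e i \<otimes> x j)"
        unfolding sumx[symmetric] using finx eI i xI by (intro finsum_rdistr) auto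
      also have "\<dots> = (\<Oplus>j\<in>{i \<in> I. x i \<noteq> \<zero>}. if i = j then x j else \<zero>)"
        using xI kill by (intro finsum_cong') auto
      also have "\<dots> = x i"
      proof (cases "x i = \<zero>")
        case True
        have "(\<Oplus>j\<in>{i \<in> I. x i \<noteq> \<zero>}. if i = j then x j else \<zero>)
            = (\<Oplus>j\<in>{i \<in> I. x i \<noteq> \<zero>}. \<zero>)"
          using True by (intro finsum_cong') auto
        then show ?thesis using True by simp
      qed (use finx i xI in \<open>intro add.finprod_singleton; auto\<close>)
      finally show ?thesis by simp
    qed
    show "x = (\<lambda>i\<in>I. e i \<otimes> y)"
      using x by (intro extensionalityI[of _ I]) (auto simp: PiE_iff proj)
  qed
  then show ?thesis
    by (simp add: is_direct_sum_iff abelian_group_axioms subgroup_peirce eI)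
qed

end

section \<open>Gradings concentrated in the neutral degree\<close>

definition trivial_grading :: "('g, 'm) monoid_scheme \<Rightarrow> ('a, 'r) ring_scheme \<Rightarrow> 'g \<Rightarrow> 'a set" where
  "trivial_grading G R g = (if g = \<one>\<^bsub>G\<^esub> then carrier R else {\<zero>\<^bsub>R\<^esub>})"

lemma (in cring) trivial_grading_eq_peirce:
  "trivial_grading G R = peirce R (\<lambda>g. if g = \<one>\<^bsub>G\<^esub> then \<one> else \<zero>)"
  by (auto simp: fun_eq_iff trivial_grading_def peirce_def)

lemma (in cring) complete_orthogonal_trivial:
  assumes "i \<in> I"
  shows "complete_orthogonal R I (\<lambda>j. if j = i then \<one> else \<zero>)"
proof (cases "\<one> = \<zero>")
  case True
  then show ?thesis by (auto simp: complete_orthogonal_def)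
next
  case False
  then have "{j \<in> I. (if j = i then \<one> else \<zero>) \<noteq> \<zero>} = {i}" using assms by auto
  then show ?thesis by (auto simp: complete_orthogonal_def)
qed

lemma (in cring) graded_ring_trivial:
  assumes "comm_group G"
  shows "graded_ring G R (trivial_grading G R)"
proof -
  interpret G: comm_group G by fact
  have "is_direct_sum R (carrier G) (trivial_grading G R)"
    unfolding trivial_grading_eq_peirce
    by (intro is_direct_sum_peirce complete_orthogonal_trivial) simp
  then show ?thesis
    using assms cring_axioms by (auto simp: graded_ring_def trivial_grading_def)
qed

text \<open>
  Every element is the sum of its homogeneous components, and those that do not vanish all have
  their degree in the kernel of \<open>\<psi>\<close>.
\<close>

lemma coarsening_concentrated:
  assumes M: "abelian_group M" and sum: "is_direct_sum M (carrier G) \<M>"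
    and conc: "\<And>g. g \<in> carrier G \<Longrightarrow> \<psi> g \<noteq> \<one>\<^bsub>H\<^esub> \<Longrightarrow> \<M> g = {\<zero>\<^bsub>M\<^esub>}"
  shows "coarsening G \<psi> M \<M> = trivial_grading H M"
proof
  fix h
  interpret M: abelian_group M by fact
  have sub: "\<M> g \<subseteq> carrier M" if "g \<in> carrier G" for g
    using sum that subgroup.subset unfolding is_direct_sum_def by fastforce
  show "coarsening G \<psi> M \<M> h = trivial_grading H M h"
  proof (cases "h = \<one>\<^bsub>H\<^esub>")
    case False
    have "(\<Oplus>\<^bsub>M\<^esub>g\<in>S. x g) = \<zero>\<^bsub>M\<^esub>"
      if "S \<subseteq> {g \<in> carrier G. \<psi> g = h}" "x \<in> Pi S \<M>" for S x
    proof -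
      have "x g = \<zero>\<^bsub>M\<^esub>" if "g \<in> S" for g
      proof -
        have "x g \<in> \<M> g" "g \<in> carrier G" "\<psi> g = h"
          using \<open>S \<subseteq> _\<close> \<open>x \<in> Pi S \<M>\<close> that by auto
        then show ?thesis using conc[of g] False by auto
      qed
      then show ?thesis by (intro M.add.finprod_one_eqI) simp
    qed
    then have "coarsening G \<psi> M \<M> h \<subseteq> {\<zero>\<^bsub>M\<^esub>}" unfolding coarsening_def by blast
    moreover have "\<zero>\<^bsub>M\<^esub> \<in> coarsening G \<psi> M \<M> h"
      unfolding coarsening_def by (intro CollectI exI[of _ "{}"]) simp
    ultimately show ?thesis using False by (auto simp: trivial_grading_def)
  next
    case True
    have "y \<in> coarsening G \<psi> M \<M> h" if "y \<in> carrier M" for y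
    proof -
      have "\<exists>!x. x \<in> (\<Pi>\<^sub>E i\<in>carrier G. \<M> i) \<and> finite {i \<in> carrier G. x i \<noteq> \<zero>\<^bsub>M\<^esub>} \<and>
          (\<Oplus>\<^bsub>M\<^esub>i\<in>{i \<in> carrier G. x i \<noteq> \<zero>\<^bsub>M\<^esub>}. x i) = y"
        using sum[unfolded is_direct_sum_iff[OF M]] that by blast
      then obtain x where x: "x \<in> (\<Pi>\<^sub>E i\<in>carrier G. \<M> i)"
        "finite {i \<in> carrier G. x i \<noteq> \<zero>\<^bsub>M\<^esub>}"
        "(\<Oplus>\<^bsub>M\<^esub>i\<in>{i \<in> carrier G. x i \<noteq> \<zero>\<^bsub>M\<^esub>}. x i) = y" by blast
      have "\<psi> g = h" if "g \<in> carrier G" "x g \<noteq> \<zero>\<^bsub>M\<^esub>" for g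
        using conc[of g] x(1) that True by (auto simp: PiE_iff)
      then show ?thesis
        unfolding coarsening_def using x
        by (intro CollectI exI[of _ "{i \<in> carrier G. x i \<noteq> \<zero>\<^bsub>M\<^esub>}"] exI[of _ x]) auto
    qed
    moreover have "coarsening G \<psi> M \<M> h \<subseteq> carrier M"
      unfolding coarsening_def using sub by (fastforce intro!: M.finsum_closed)
    ultimately show ?thesis using True by (auto simp: trivial_grading_def)
  qed
qed

section \<open>Gradings of a ring as a module over itself\<close>

definition regular_module :: "'a ring \<Rightarrow> ('a, 'a) module" where
  "regular_module R =
     \<lparr>carrier = carrier R, monoid.mult = (\<otimes>\<^bsub>R\<^esub>), one = \<one>\<^bsub>R\<^esub>, ring.zero = \<zero>\<^bsub>R\<^esub>, ring.add = (\<oplus>\<^bsub>R\<^esub>),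
      smult = (\<otimes>\<^bsub>R\<^esub>)\<rparr>"

lemma regular_module_simps [simp]:
  "carrier (regular_module R) = carrier R" "\<zero>\<^bsub>regular_module R\<^esub> = \<zero>\<^bsub>R\<^esub>"
  "(\<oplus>\<^bsub>regular_module R\<^esub>) = (\<oplus>\<^bsub>R\<^esub>)" "x \<odot>\<^bsub>regular_module R\<^esub> y = x \<otimes>\<^bsub>R\<^esub> y"
  by (simp_all add: regular_module_def)

lemma trivial_grading_regular_module:
  "trivial_grading G (regular_module R) = trivial_grading G R"
  by (simp add: trivial_grading_def fun_eq_iff)

lemma module_regular_module:
  assumes "cring R" shows "Module.module R (regular_module R)"
proof -
  interpret cring R by fact
  show ?thesis
    by (rule moduleI)
      (auto simp: cring_axioms l_distr r_distr m_assoc a_ac intro!: abelian_groupI intro: l_neg)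
qed

lemma finsum_regular_module:
  "finsum (regular_module R) x S = finsum R x S"
  by (simp add: finsum_def finprod_def)

lemma is_direct_sum_regular_module:
  assumes "cring R"
  shows "is_direct_sum (regular_module R) I A \<longleftrightarrow> is_direct_sum R I A"
proof -
  interpret cring R by fact
  interpret M: Module.module R "regular_module R" by (rule module_regular_module) fact
  have "subgroup B (add_monoid (regular_module R)) \<longleftrightarrow> subgroup B (add_monoid R)" for B
    by (simp add: subgroup_def m_inv_def)
  then show ?thesis
    by (simp add: is_direct_sum_iff abelian_group_axioms M.M.abelian_group_axioms
        finsum_regular_module)
qed

lemma graded_module_peirce:
  assumes "comm_group G" "cring R" and e: "complete_orthogonal R (carrier G) e"
  shows "graded_module G R (trivial_grading G R) (regular_module R) (peirce R e)"
proof -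
  interpret G: comm_group G by fact
  interpret R: cring R by fact
  have eG: "e g \<in> carrier R" if "g \<in> carrier G" for g
    using e that by (auto simp: complete_orthogonal_def)
  have "a \<otimes>\<^bsub>R\<^esub> x \<in> peirce R e (g \<otimes>\<^bsub>G\<^esub> h)"
    if gh: "g \<in> carrier G" "h \<in> carrier G"
      and a: "a \<in> trivial_grading G R g" and x: "x \<in> peirce R e h" for g h a x
  proof (cases "g = \<one>\<^bsub>G\<^esub>")
    case True
    then show ?thesis
      using a x gh eG R.m_lcomm[of "e h" a x]
      by (simp add: trivial_grading_def peirce_def)
  next
    case False
    then show ?thesis using a x gh eG by (simp add: trivial_grading_def peirce_def)
  qed
  then show ?thesis
    unfolding graded_module_def
    using R.graded_ring_trivial[OF \<open>comm_group G\<close>] module_regular_module[OF \<open>cring R\<close>]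
      R.is_direct_sum_peirce[OF e]
    by (simp add: is_direct_sum_regular_module assms(2))
qed

text \<open>
  An element \<open>x = e g \<otimes> x\<close> of degree \<open>g\<close> is annihilated by \<open>1 - e g \<noteq> 0\<close>. Hence a homogeneous
  basis would be empty, but \<open>R\<close> is not the zero ring.
\<close>

lemma not_graded_free_peirce:
  assumes "group G" "cring R"
    and e: "\<And>g. g \<in> carrier G \<Longrightarrow> e g \<in> carrier R \<and> e g \<noteq> \<one>\<^bsub>R\<^esub>"
  shows "\<not> graded_free G R (regular_module R) (peirce R e)"
proof
  interpret G: group G by fact
  interpret R: cring R by fact
  interpret Module.module R "regular_module R" by (rule module_regular_module) fact
  assume "graded_free G R (regular_module R) (peirce R e)"
  then obtain B where B: "B \<subseteq> (\<Union>g\<in>carrier G. peirce R e g)"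
    "span B = carrier R" "\<not> lin_dep B"
    by (auto simp: graded_free_def homogeneous_basis_def)
  have "b \<notin> B" for b
  proof
    assume b: "b \<in> B"
    with B(1) obtain g where g: "g \<in> carrier G" "b \<in> carrier R" "e g \<otimes>\<^bsub>R\<^esub> b = b"
      by (auto simp: peirce_def)
    let ?c = "\<one>\<^bsub>R\<^esub> \<ominus>\<^bsub>R\<^esub> e g"
    have c: "?c \<in> carrier R" "?c \<noteq> \<zero>\<^bsub>R\<^esub>"
      using e[OF g(1)] by auto
    have "?c \<otimes>\<^bsub>R\<^esub> b = b \<ominus>\<^bsub>R\<^esub> e g \<otimes>\<^bsub>R\<^esub> b"
      using e[OF g(1)] g by (simp add: R.minus_eq R.l_distr R.l_minus)
    then have "?c \<otimes>\<^bsub>R\<^esub> b = \<zero>\<^bsub>R\<^esub>" using g by (simp add: R.r_right_minus_eq)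
    then have "lincomb (\<lambda>_. ?c) {b} = \<zero>\<^bsub>regular_module R\<^esub>"
      using c g by (simp add: lincomb_def)
    then have "lin_dep B"
      unfolding lin_dep_def using b c
      by (intro exI[of _ "{b}"] exI[of _ "\<lambda>_. ?c"] exI[of _ b]) auto
    with B(3) show False ..
  qed
  then have "B = {}" by blast
  then have "carrier R = {\<zero>\<^bsub>R\<^esub>}"
    using B(2) by (auto simp: span_def lincomb_def)
  then show False using e[OF G.one_closed] R.one_closed by simp
qed

lemma graded_free_regular_module:
  assumes "group G" "cring R"
  shows "graded_free_of_rank G R (regular_module R) (trivial_grading G R) 1"
proof -
  interpret G: group G by fact
  interpret R: cring R by fact
  interpret Module.module R "regular_module R" by (rule module_regular_module) fact
  have lc: "lincomb a {\<one>\<^bsub>R\<^esub>} = a \<one>\<^bsub>R\<^esub>" if "a \<in> {\<one>\<^bsub>R\<^esub>} \<rightarrow> carrier R" for a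
    using that by (simp add: lincomb_def)
  have "\<one>\<^bsub>R\<^esub> \<in> trivial_grading G R \<one>\<^bsub>G\<^esub>" by (simp add: trivial_grading_def)
  then have "{\<one>\<^bsub>R\<^esub>} \<subseteq> (\<Union>g\<in>carrier G. trivial_grading G R g)"
    using G.one_closed by blast
  moreover have "span {\<one>\<^bsub>R\<^esub>} = carrier R"
  proof
    show "carrier R \<subseteq> span {\<one>\<^bsub>R\<^esub>}"
    proof
      fix x assume "x \<in> carrier R"
      then show "x \<in> span {\<one>\<^bsub>R\<^esub>}"
        unfolding span_def using lc[of "\<lambda>_. x"]
        by (intro CollectI exI[of _ "\<lambda>_. x"] exI[of _ "{\<one>\<^bsub>R\<^esub>}"]) auto
    qed
  qed (use lc finite_span[of "{\<one>\<^bsub>R\<^esub>}"] in auto)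
  moreover have "\<not> lin_dep {\<one>\<^bsub>R\<^esub>}"
    using lc by (intro finite_lin_indpt2) auto
  ultimately have "homogeneous_basis G R (regular_module R) (trivial_grading G R) {\<one>\<^bsub>R\<^esub>}"
    by (simp add: homogeneous_basis_def)
  then show ?thesis
    unfolding graded_free_of_rank_def by (intro exI[of _ "{\<one>\<^bsub>R\<^esub>}"]) simp
qed

section \<open>The example\<close>

lemma complete_orthogonal_residue_ring_6:
  assumes "i \<in> I" "k \<in> I" "i \<noteq> k"
  shows "complete_orthogonal (residue_ring 6) I (\<lambda>j. if j = i then 3 else if j = k then 4 else 0)"
proof -
  interpret residues 6 "residue_ring 6" by unfold_locales simp_all
  have supp: "{j \<in> I. (if j = i then 3 else if j = k then 4 else 0) \<noteq> (0 :: int)} = {i, k}"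
    using assms by auto
  have "(\<Oplus>\<^bsub>residue_ring 6\<^esub>j\<in>{i, k}. if j = i then 3 else if j = k then 4 else 0) = 1"
    using assms by (simp add: res_carrier_eq res_add_eq res_zero_eq)
  then show ?thesis
    unfolding complete_orthogonal_def
    using supp by (auto simp: res_carrier_eq res_mult_eq res_zero_eq res_one_eq)
qed

theorem mainTheorem7:
  fixes G :: "('g, 'm) monoid_scheme" and H :: "('h, 'n) monoid_scheme" and \<psi> :: "'g \<Rightarrow> 'h"
  assumes "comm_group G" and "comm_group H"
    and "\<psi> \<in> epi G H" and "\<psi> \<notin> iso G H"
  shows "\<exists>(R :: int ring) (\<R> :: 'g \<Rightarrow> int set) (M :: (int, int) module) (\<M> :: 'g \<Rightarrow> int set).
           graded_ring G R \<R> \<and> graded_module G R \<R> M \<M> \<and>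
           \<not> graded_free G R M \<M> \<and>
           graded_module H R (coarsening G \<psi> R \<R>) M (coarsening G \<psi> M \<M>) \<and>
           graded_free_of_rank H R M (coarsening G \<psi> M \<M>) 1"
proof -
  interpret G: comm_group G by fact
  interpret H: comm_group H by fact
  interpret \<psi>: group_hom G H \<psi>
    using assms(3) by unfold_locales (simp add: epi_def)
  have "\<not> inj_on \<psi> (carrier G)"
    using assms(3,4) by (auto simp: epi_def iso_def bij_betw_def)
  then obtain k where k: "k \<in> carrier G" "k \<noteq> \<one>\<^bsub>G\<^esub>" "\<psi> k = \<one>\<^bsub>H\<^esub>"
    using \<psi>.inj_on_one_iff by auto

  define R where "R = residue_ring 6"
  define M where "M = regular_module R"
  define e :: "'g \<Rightarrow> int" where "e = (\<lambda>g. if g = \<one>\<^bsub>G\<^esub> then 3 else if g = k then 4 else 0)"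
  interpret residues 6 R unfolding R_def by unfold_locales simp_all
  interpret M: Module.module R M unfolding M_def by (rule module_regular_module) (rule cring)
  have e: "complete_orthogonal R (carrier G) e"
    unfolding R_def e_def using k by (intro complete_orthogonal_residue_ring_6) auto

  have ring: "graded_ring G R (trivial_grading G R)"
    by (rule graded_ring_trivial) fact
  have mod: "graded_module G R (trivial_grading G R) M (peirce R e)"
    unfolding M_def using assms(1) cring e by (rule graded_module_peirce)
  have not_free: "\<not> graded_free G R M (peirce R e)"
    unfolding M_def using cring
    by (rule not_graded_free_peirce[OF G.group_axioms])
      (simp add: e_def res_carrier_eq res_one_eq)
  have cR: "coarsening G \<psi> R (trivial_grading G R) = trivial_grading H R"
    using ring unfolding graded_ring_def
    by (intro coarsening_concentrated abelian_group_axioms) (auto simp: trivial_grading_def)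
  have "coarsening G \<psi> M (peirce R e) = trivial_grading H M"
  proof (rule coarsening_concentrated[OF M.M.abelian_group_axioms])
    show "is_direct_sum M (carrier G) (peirce R e)"
      using mod by (simp add: graded_module_def)
    fix g assume "g \<in> carrier G" "\<psi> g \<noteq> \<one>\<^bsub>H\<^esub>"
    then have "e g = \<zero>\<^bsub>R\<^esub>" using k by (auto simp: e_def res_zero_eq)
    then show "peirce R e g = {\<zero>\<^bsub>M\<^esub>}" by (auto simp: peirce_def M_def)
  qed
  then have cM: "coarsening G \<psi> M (peirce R e) = trivial_grading H R"
    by (simp add: M_def trivial_grading_regular_module)
  have "graded_module H R (trivial_grading H R) M (trivial_grading H R)"
    unfolding M_def
    by (subst (2) trivial_grading_eq_peirce)
      (intro graded_module_peirce complete_orthogonal_trivial assms(2) cring H.one_closed)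
  moreover have "graded_free_of_rank H R M (trivial_grading H R) 1"
    unfolding M_def by (rule graded_free_regular_module[OF H.group_axioms cring])
  ultimately show ?thesis
    using ring mod not_free
    by (intro exI[of _ R] exI[of _ "trivial_grading G R"] exI[of _ M] exI[of _ "peirce R e"])
      (simp add: cR cM)
qed

end
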